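(* Let $p$ and $q$ be distinct odd prime numbers and let $p^{*}=(-1)^{\frac{p-1}{2}}p$. Then $$\left(\frac{p^{*}}{q}\right)=1 \iff \left(\frac{q}{p}\right)=1,$$ or, in other words, $$\left(\frac{p}{q}\right)\left(\frac{q}{p}\right)=(-1)^{\frac{p-1}{2}\cdot\frac{q-1}{2}}.$$
   Context: For an odd prime $\ell$ and an integer $a$ not divisible by $\ell$, $\left(\frac{a}{\ell}\right)\in\{1,-1\}$ denotes the Legendre symbol: it equals $1$ if $a$ is a square modulo $\ell$ and $-1$ otherwise. *)

theory Defs
  imports "HOL-Number_Theory.Number_Theory"
begin

definition signed_prime :: "nat \<Rightarrow> int"
  where "signed_prime p = (-1) ^ ((p - 1) div 2) * int p"

end

theory Submission
  imports Defs
begin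

text \<open>The product formula is the library's \<open>Quadratic_Reciprocity\<close>. By Euler's
  criterion, pulling the sign out of \<open>signed_prime p\<close> multiplies the symbol by
  (-1)^((p-1)/2 * (q-1)/2), which is exactly the reciprocity sign
  (\<open>Legendre_minus_one_power_mult\<close>). Hence the symbols of p* over q and of q over p are
  equal, which gives the equivalence.\<close>

lemma Legendre_cases: "Legendre a m = -1 \<or> Legendre a m = 0 \<or> Legendre a m = 1"
  by (simp add: Legendre_def)

text \<open>Modulo q the symbol is the power with exponent (q-1)/2, which is multiplicative; the
  resulting congruence between numbers in {-1, 0, 1} is an equality because q > 2.\<close>

lemma Legendre_minus_one_power_mult:
  fixes q :: nat
  assumes "prime q" and "2 < q"
  shows "Legendre ((-1) ^ k * a) (int q) = (-1) ^ (k * ((q - 1) div 2)) * Legendre a (int q)"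
proof -
  let ?e = "(q - 1) div 2"
  have "[Legendre ((-1) ^ k * a) (int q) = ((-1) ^ k * a) ^ ?e] (mod int q)"
    using euler_criterion[OF assms] .
  also have "((-1) ^ k * a) ^ ?e = (-1) ^ (k * ?e) * a ^ ?e"
    by (simp add: power_mult_distrib power_mult)
  also have "[\<dots> = (-1) ^ (k * ?e) * Legendre a (int q)] (mod int q)"
    by (intro cong_mult cong_refl cong_sym[OF euler_criterion[OF assms]])
  finally have cong: "[Legendre ((-1) ^ k * a) (int q)
      = (-1) ^ (k * ?e) * Legendre a (int q)] (mod int q)" .
  have "\<bar>(-1) ^ (k * ?e) * Legendre a (int q)\<bar> \<le> 1"
    using Legendre_cases[of a "int q"] by (auto simp: abs_mult)
  moreover have "\<bar>Legendre ((-1) ^ k * a) (int q)\<bar> \<le> 1"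
    using Legendre_cases[of "(-1) ^ k * a" "int q"] by auto
  \<comment> \<open>Two values in [-1, 1] differ by at most 2, so \<open>2 < q\<close> leaves 0 as
    the only possible multiple of q.\<close>
  ultimately have
    "\<bar>Legendre ((-1) ^ k * a) (int q) - (-1) ^ (k * ?e) * Legendre a (int q)\<bar> < int q"
    using assms(2) by linarith
  moreover have "int q dvd Legendre ((-1) ^ k * a) (int q) - (-1) ^ (k * ?e) * Legendre a (int q)"
    using cong by (simp add: cong_iff_dvd_diff)
  ultimately show ?thesis
    using dvd_imp_le_int by (metis abs_of_nat eq_iff_diff_eq_0 not_le)
qed

theorem mainTheorem1:
  fixes p q :: nat
  assumes "prime p" and "odd p"
    and "prime q" and "odd q"
    and "p \<noteq> q"
  shows "(Legendre (signed_prime p) (int q) = 1 \<longleftrightarrow> Legendre (int q) (int p) = 1)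
    \<and> Legendre (int p) (int q) * Legendre (int q) (int p)
        = (-1) ^ (((p - 1) div 2) * ((q - 1) div 2))"
proof -
  let ?s = "(-1::int) ^ (((p - 1) div 2) * ((q - 1) div 2))"
  have gt: "2 < p" "2 < q"
    using prime_ge_2_nat[OF assms(1)] prime_ge_2_nat[OF assms(3)] assms(2,4)
    by (auto simp: order.order_iff_strict)
  have recip: "Legendre (int p) (int q) * Legendre (int q) (int p) = ?s"
    using Quadratic_Reciprocity assms gt by blast
  have "Legendre (signed_prime p) (int q) = ?s * Legendre (int p) (int q)"
    unfolding signed_prime_def using Legendre_minus_one_power_mult assms gt by blast
  also have "\<dots> = Legendre (int q) (int p)"
  proof -
    \<comment> \<open>Since \<open>?s\<close> is nonzero, \<open>recip\<close> excludes the value 0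
      for the symbol of p over q. That symbol thus squares to 1, and multiplying
      \<open>recip\<close> by it isolates the other symbol.\<close>
    have "?s = 1 \<or> ?s = -1"
      by (metis minus_one_power_iff)
    then show ?thesis
      using recip Legendre_cases[of "int p" "int q"] by auto
  qed
  finally show ?thesis
    using recip by simp
qed

end
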